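(* Let $(\xi_n)$ satisfy the noise assumption, let $f$ satisfy Assumption A, and let $\underline\beta_*=\inf\mathcal S$ (see context). Suppose that for some $\theta\in(0,K)$ and constants $\tilde L^-\ge\tilde L^+>1$, $a_1,a_2>0$: $$f(x)-K\le\tilde L^-(K-x)\ \text{ for } x\in[K-\theta,K],\qquad K-f(x)\le\tilde L^+(x-K)\ \text{ for } x\in[K,K+\theta],$$ $$f(x)>a_1(K-x)+K\ \text{ for } x\in(K-\theta,K),\qquad f(x)<a_2(K-x)+K\ \text{ for } x\in(K,K+\theta).$$ For $\beta\in[0,1]$ put $\mathcal L^{\pm}(\beta):=(1-\beta)\tilde L^{\pm}-\beta$. Let $(\alpha,\ell)$ satisfy $$\alpha\in(0,\underline\beta_* ),\qquad \ell\in\bigl(\underline\beta_*-\alpha,\ \min\{\alpha,1-\alpha\}\bigr),\qquad \alpha+\ell\le\min\left\{\frac{a_1}{a_1+1},\frac{a_2}{a_2+1}\right\},$$ and $$\mathbb E\ln\left|\mathcal L^-(\alpha+\ell\xi)\,\mathcal L^+(\alpha+\ell\xi)\right|=-\lambda_0<0$$ for some $\lambda_0>0$, where $\xi$ has the common distribution of the $\xi_n$. Then for any $x_0>0$ the solution of $$x_{n+1}=(1-\alpha-\ell\xi_{n+1})f(x_n)+(\alpha+\ell\xi_{n+1})x_n,\qquad n=0,1,2,\dots,$$ satisfies $\lim_{n\to\infty}x_n=K$ almost surely.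
   Context: Noise assumption: $(\xi_n)_{n\in\mathbb N}$ is a sequence of independent identically distributed random variables on a probability space $(\Omega,\mathcal F,\mathbb P)$ with $|\xi_n|\le1$ for all $n$, and $\mathbb P\{\xi_n\in(1-\varepsilon,1]\}>0$ for each $\varepsilon>0$. Assumption A on $f$: $f:[0,\infty)\to[0,\infty)$ is continuous, $f(0)=0$, $f$ has exactly one positive equilibrium (fixed point) $K>0$, which is locally unstable (not Lyapunov stable) for $x_{n+1}=f(x_n)$; $f(x)>x$ for $x\in(0,K)$ and $0<f(x)<x$ for $x\in(K,\infty)$. Notation: $f_m:=\max_{x\in[0,K]}f(x)$; $f^2_m$ denotes the number $f^2_m:=\inf\{f(x):x\in(K,f_m)\}$ (not a square). One has $0<f^2_m<K<f_m$. For $\beta\in[0,1)$, $x\ge0$: $G(\beta,x):=(1-\beta)f(x)+\beta x$, and $G^2(\beta,x):=G(\beta,G(\beta,x))$. Set $\mathcal S:=\{\beta\in(0,1): G^2(\beta,x)>x \text{ for all } x\in(f^2_m,K),\ G^2(\beta,x)<x\text{ for all }x\in(K,f_m)\}$ and $\underline\beta_*:=\inf\mathcal S$. *)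

theory Defs
  imports "HOL-Probability.Probability"
begin

text \<open>
  The noise is indexed by \<open>n \<ge> 1\<close>, since the difference equation only uses \<open>\<xi> (Suc n)\<close>;
  nothing is assumed about \<open>\<xi> 0\<close>. Measurability of the \<open>\<xi> n\<close> is part of \<open>indep_vars\<close>.
\<close>
locale iid_noise = prob_space M
  for M :: "'a measure" +
  fixes \<xi> :: "nat \<Rightarrow> 'a \<Rightarrow> real"
  assumes indep: "indep_vars (\<lambda>_. borel) \<xi> {1..}"
    and ident: "\<And>n. n \<ge> 1 \<Longrightarrow> distr M borel (\<xi> n) = distr M borel (\<xi> 1)"
    and bounded: "\<And>n \<omega>. n \<ge> 1 \<Longrightarrow> \<omega> \<in> space M \<Longrightarrow> \<bar>\<xi> n \<omega>\<bar> \<le> 1"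
    and near_one: "\<And>n \<epsilon>. n \<ge> 1 \<Longrightarrow> \<epsilon> > 0 \<Longrightarrow>
      prob {\<omega> \<in> space M. \<xi> n \<omega> \<in> {1 - \<epsilon><..1}} > 0"

definition lyapunov_stable :: "(real \<Rightarrow> real) \<Rightarrow> real \<Rightarrow> bool" where
  "lyapunov_stable f K \<longleftrightarrow>
    (\<forall>\<epsilon>>0. \<exists>\<delta>>0. \<forall>y\<ge>0. \<bar>y - K\<bar> < \<delta> \<longrightarrow> (\<forall>n. \<bar>(f ^^ n) y - K\<bar> < \<epsilon>))"

text \<open>
  A map \<open>[0,\<infinity>) \<rightarrow> [0,\<infinity>)\<close> is represented by a total function on the reals whose values at
  negative arguments are irrelevant.
\<close>
locale unstable_map =
  fixes f :: "real \<Rightarrow> real" and K :: real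
  assumes cont: "continuous_on {0..} f"
    and maps: "f ` {0..} \<subseteq> {0..}"
    and zero: "f 0 = 0"
    and K_pos: "K > 0"
    and fixed: "f K = K"
    and fixed_unique: "\<And>x. x > 0 \<Longrightarrow> f x = x \<Longrightarrow> x = K"
    and unstable: "\<not> lyapunov_stable f K"
    and above: "\<And>x. x \<in> {0<..<K} \<Longrightarrow> f x > x"
    and below: "\<And>x. x \<in> {K<..} \<Longrightarrow> 0 < f x \<and> f x < x"

text \<open>The supremum is attained because \<open>f\<close> is continuous on the compact interval.\<close>
definition f_max :: "(real \<Rightarrow> real) \<Rightarrow> real \<Rightarrow> real" where
  "f_max f K = Sup (f ` {0..K})"

definition f2_min :: "(real \<Rightarrow> real) \<Rightarrow> real \<Rightarrow> real" where
  "f2_min f K = Inf (f ` {K<..<f_max f K})"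

definition G :: "(real \<Rightarrow> real) \<Rightarrow> real \<Rightarrow> real \<Rightarrow> real" where
  "G f \<beta> x = (1 - \<beta>) * f x + \<beta> * x"

definition S_set :: "(real \<Rightarrow> real) \<Rightarrow> real \<Rightarrow> real set" where
  "S_set f K = {\<beta> \<in> {0<..<1}.
     (\<forall>x \<in> {f2_min f K<..<K}. G f \<beta> (G f \<beta> x) > x) \<and>
     (\<forall>x \<in> {K<..<f_max f K}. G f \<beta> (G f \<beta> x) < x)}"

text \<open>
  The infimum is a genuine one when \<open>f\<close> satisfies one-sided linear bounds at \<open>K\<close> (that is,
  \<open>f x - K \<le> L * (K - x)\<close> to the left and \<open>K - f x \<le> L * (x - K)\<close> to the right):
  for \<open>\<beta>\<close> close to 1, \<open>G f \<beta>\<close> then maps each side of \<open>K\<close> (within the ranges in question) into that side or to \<open>K\<close>,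
  so \<open>S_set f K\<close> is nonempty.
\<close>
definition beta_star :: "(real \<Rightarrow> real) \<Rightarrow> real \<Rightarrow> real" where
  "beta_star f K = Inf (S_set f K)"

definition ctrl_slope :: "real \<Rightarrow> real \<Rightarrow> real" where
  "ctrl_slope L \<beta> = (1 - \<beta>) * L - \<beta>"

primrec noisy_orbit ::
  "(real \<Rightarrow> real) \<Rightarrow> real \<Rightarrow> real \<Rightarrow> (nat \<Rightarrow> real) \<Rightarrow> real \<Rightarrow> nat \<Rightarrow> real" where
  "noisy_orbit f \<alpha> l z x0 0 = x0"
| "noisy_orbit f \<alpha> l z x0 (Suc n) =
     (1 - \<alpha> - l * z (Suc n)) * f (noisy_orbit f \<alpha> l z x0 n)
     + (\<alpha> + l * z (Suc n)) * noisy_orbit f \<alpha> l z x0 n"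

end

theory Submission
  imports Defs
begin

text \<open>
  Write \<open>x\<^bsub>n+1\<^esub> = G f \<beta>\<^bsub>n+1\<^esub> x\<^bsub>n\<^esub>\<close> with the random control
  \<open>\<beta>\<^bsub>n\<^esub> = \<alpha> + l * \<xi>\<^bsub>n\<^esub>\<close>. Two mechanisms act together.

  Globally, a run of strong controls attracts. Since \<open>beta_star f K < \<alpha> + l\<close>, some
  \<open>s < \<alpha> + l\<close> lies in \<open>S_set f K\<close>, and then \<open>G f s\<close> cannot swap the two sides of \<open>K\<close> without
  moving inwards: no \<open>0 < x < K < y\<close> have \<open>G f s x \<ge> y\<close> and \<open>G f s y \<le> x\<close>
  (\<open>no_swap_if_mem_S_set\<close>). Raising the control above \<open>s\<close> only shortens the jumps, so the set of
  states that controls in \<open>{s..\<alpha> + l}\<close> can reach in \<open>n\<close> steps from a compact invariant interval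
  shrinks to \<open>{K}\<close>: the points mapped to the ends of the limit set would form a forbidden swap
  (\<open>reachable_shrinks_to_equilibrium\<close>). Hence a fixed number \<open>N\<close> of consecutive noise values close
  to \<open>1\<close> brings the orbit near \<open>K\<close>, wherever it starts (\<open>uniform_attraction\<close>).

  Locally, near \<open>K\<close> the bound on \<open>\<alpha> + l\<close> forces the orbit to jump across \<open>K\<close> at every step, and
  the distance to \<open>K\<close> is multiplied by at most \<open>ctrl_slope Lm \<beta>\<close> from the left and
  \<open>ctrl_slope Lp \<beta>\<close> from the right. The logarithm of the distance is therefore dominated by a sum of
  independent bounded variables of alternating type whose mean falls by \<open>lam0\<close> every two steps.
  Hoeffding's inequality, summed over all times, shows that such a sum stays below a line of
  negative slope forever with probability at least \<open>1 / 2\<close>, uniformly in the starting time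
  (\<open>uniform_negative_drift\<close>); on that event an orbit that starts close enough to \<open>K\<close> converges
  (\<open>noisy_orbit_tendsto_equilibrium\<close>).

  Let \<open>E\<^bsub>m\<^esub>\<close> be the event that \<open>N\<close> noise values after time \<open>m\<close> are close to \<open>1\<close> and the sums after
  time \<open>m + N\<close> have this drift. It depends only on the noise after time \<open>m\<close>, and by independence its
  probability has a positive lower bound that does not depend on \<open>m\<close>. So infinitely many of the
  \<open>E\<^bsub>m\<^esub>\<close> occur with positive probability; that is a tail event, and Kolmogorov's zero-one law makes
  it almost sure (\<open>AE_some_future_event\<close>). A single \<open>E\<^bsub>m\<^esub>\<close> already implies convergence to \<open>K\<close>.
\<close>

section \<open>The controlled map\<close>

lemma (in unstable_map) f_at_least_self:
  assumes "0 < x" "x \<le> K" shows "x \<le> f x"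
  using assms above[of x] fixed by (cases "x = K") auto

lemma (in unstable_map) f_at_most_self:
  assumes "K \<le> x" shows "f x \<le> x"
  using assms below[of x] fixed by (cases "x = K") auto

lemma (in unstable_map) f_pos: "0 < x \<Longrightarrow> 0 < f x"
  using f_at_least_self[of x] below[of x] by (cases "x \<le> K") auto

lemma (in unstable_map) G_equilibrium: "G f \<beta> K = K"
  using fixed by (simp add: G_def algebra_simps)

lemma G_eq_shift: "G f \<beta> x = x + (1 - \<beta>) * (f x - x)"
  by (simp add: G_def algebra_simps)

lemma (in unstable_map) G_gt_self:
  assumes "0 < x" "x < K" "\<beta> < 1" shows "x < G f \<beta> x"
  using assms above[of x] by (simp add: G_eq_shift)

lemma (in unstable_map) G_lt_self:
  assumes "K < x" "\<beta> < 1" shows "G f \<beta> x < x"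
  using assms below[of x] by (simp add: G_eq_shift mult_less_0_iff)

lemma (in unstable_map) G_mono_control_left:
  assumes "0 < x" "x \<le> K" "\<beta> \<le> \<gamma>" shows "G f \<gamma> x \<le> G f \<beta> x"
  using assms f_at_least_self[of x] by (simp add: G_eq_shift mult_right_mono)

lemma (in unstable_map) G_mono_control_right:
  assumes "K \<le> x" "\<beta> \<le> \<gamma>" shows "G f \<beta> x \<le> G f \<gamma> x"
  using assms f_at_most_self[of x] by (simp add: G_eq_shift mult_right_mono_neg)

lemma (in unstable_map) continuous_on_G:
  "continuous_on (UNIV \<times> {0..}) (\<lambda>z. G f (fst z) (snd z))"
  unfolding G_def
  by (intro continuous_intros continuous_on_compose2[OF cont]) auto

lemma (in unstable_map) continuous_on_G_state:
  assumes "A \<subseteq> {0..}" shows "continuous_on A (G f \<beta>)"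
  unfolding G_def using assms
  by (intro continuous_intros continuous_on_compose2[OF cont]) auto

section \<open>Controls in the stabilising set\<close>

lemma (in unstable_map) bdd_above_hump: "bdd_above (f ` {0..K})"
  by (intro bounded_imp_bdd_above compact_imp_bounded compact_continuous_image
      continuous_on_subset[OF cont]) auto

lemma (in unstable_map) f_le_f_max: "0 \<le> x \<Longrightarrow> x \<le> K \<Longrightarrow> f x \<le> f_max f K"
  unfolding f_max_def by (intro cSup_upper bdd_above_hump) auto

lemma (in unstable_map) equilibrium_le_f_max: "K \<le> f_max f K"
  using f_le_f_max[of K] K_pos fixed by simp

lemma (in unstable_map) f2_min_le_f:
  assumes "K < y" "y < f_max f K" shows "f2_min f K \<le> f y"
  unfolding f2_min_def
proof (rule cInf_lower)
  show "bdd_below (f ` {K<..<f_max f K})"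
    using below by (intro bdd_belowI[of _ 0]) (auto simp: less_imp_le)
qed (use assms in auto)

text \<open>
  If the two sides could be swapped, the intermediate value theorem would give a point
  \<open>p\<close> between \<open>x\<close> and \<open>K\<close> with \<open>G f s p = y\<close>, and the second iterate would bring \<open>p\<close> back to a
  point not above \<open>x \<le> p\<close>. Membership in \<open>S_set\<close> excludes this on
  \<open>{f2_min f K<..<K}\<close>; a smaller \<open>p\<close> is excluded because a step from a point between \<open>K\<close> and
  \<open>f_max f K\<close> ends strictly above \<open>f2_min f K\<close>.
\<close>
lemma (in unstable_map) no_swap_if_mem_S_set:
  assumes s: "s \<in> S_set f K"
    and xy: "0 < x" "x < K" "K < y"
    and up: "y \<le> G f s x" and down: "G f s y \<le> x"
  shows False
proof -
  have s01: "0 < s" "s < 1"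
    and S: "\<And>x. x \<in> {f2_min f K<..<K} \<Longrightarrow> x < G f s (G f s x)"
    using s by (auto simp: S_set_def)
  have "\<exists>p. x \<le> p \<and> p \<le> K \<and> G f s p = y"
    using xy up G_equilibrium by (intro IVT2' continuous_on_G_state) auto
  then obtain p where p: "x \<le> p" "p \<le> K" "G f s p = y" by blast
  have "p \<noteq> K" using p(3) xy(3) G_equilibrium by auto
  hence pK: "p < K" and p0: "0 < p" using p xy by auto
  show False
  proof (cases "f2_min f K < p")
    case True
    thus False using S[of p] pK p down by auto
  next
    case False
    have y_lt: "y < f_max f K"
    proof -
      have "(1 - s) * f p \<le> (1 - s) * f_max f K"
        using f_le_f_max[of p] p0 pK s01 by (intro mult_left_mono) auto
      hence "y \<le> (1 - s) * f_max f K + s * p" using p(3) by (simp add: G_def)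
      moreover have "s * p < s * f_max f K"
        using pK equilibrium_le_f_max s01 by simp
      ultimately show ?thesis by (simp add: algebra_simps)
    qed
    have fy: "f2_min f K \<le> f y" "f y < y" using f2_min_le_f[of y] y_lt xy below[of y] by auto
    have "f2_min f K < G f s y"
    proof -
      have "0 < s * (y - f y)" using fy s01 by simp
      thus ?thesis using fy by (simp add: G_def algebra_simps)
    qed
    thus False using down p False by simp
  qed
qed

text \<open>
  Without this, \<open>beta_star f K\<close> would be an infimum over the empty set and say nothing
  about \<open>S_set f K\<close>. The one-sided linear bounds near \<open>K\<close> extend to all states with a larger slope
  \<open>L\<close>, and for the control \<open>L / (1 + L)\<close> no step crosses \<open>K\<close>, so that every step, and hence every
  second iterate, moves towards \<open>K\<close>.
\<close>
lemma (in unstable_map) S_set_nonempty: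
  assumes hump: "K < f_max f K" and \<theta>: "0 < \<theta>"
    and left: "\<And>x. x \<in> {K - \<theta>..K} \<Longrightarrow> f x - K \<le> L1 * (K - x)"
    and right: "\<And>x. x \<in> {K..K + \<theta>} \<Longrightarrow> K - f x \<le> L2 * (x - K)"
  shows "S_set f K \<noteq> {}"
proof -
  define F where "F = f_max f K"
  \<comment> \<open>Beyond distance \<open>\<theta>\<close> the ratios \<open>F / \<theta>\<close> and \<open>K / \<theta>\<close> bound the slope, since \<open>0 < f x\<close>
    everywhere and \<open>f x \<le> F\<close> left of \<open>K\<close>.\<close>
  define L where "L = Max {1, L1, L2, F / \<theta>, K / \<theta>}"
  have L: "1 \<le> L" "L1 \<le> L" "L2 \<le> L" "F / \<theta> \<le> L" "K / \<theta> \<le> L"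
    by (simp_all add: L_def)
  define \<beta> where "\<beta> = L / (1 + L)"
  have \<beta>: "0 < \<beta>" "\<beta> < 1" and eq: "(1 - \<beta>) * L = \<beta>"
    using L(1) by (auto simp: \<beta>_def field_simps)
  have left_stays: "G f \<beta> x \<le> K" if x: "0 < x" "x \<le> K" for x
  proof -
    have "f x - K \<le> L * (K - x)"
    proof (cases "K - \<theta> \<le> x")
      case True
      have "f x - K \<le> L1 * (K - x)" using left[of x] True x by auto
      also have "\<dots> \<le> L * (K - x)" using L x by (intro mult_right_mono) auto
      finally show ?thesis .
    next
      case False
      have "f x - K \<le> F / \<theta> * \<theta>" using f_le_f_max[of x] x K_pos \<theta> by (simp add: F_def)
      also have "\<dots> \<le> L * \<theta>" using L \<theta> by (intro mult_right_mono) auto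
      also have "\<dots> \<le> L * (K - x)" using L False by (intro mult_left_mono) auto
      finally show ?thesis .
    qed
    hence "(1 - \<beta>) * (f x - K) \<le> (1 - \<beta>) * (L * (K - x))" using \<beta> by (intro mult_left_mono) auto
    also have "\<dots> = \<beta> * (K - x)" by (simp only: mult.assoc[symmetric] eq)
    finally show ?thesis by (simp add: G_def algebra_simps)
  qed
  have right_stays: "K \<le> G f \<beta> x" if x: "K \<le> x" for x
  proof -
    have "K - f x \<le> L * (x - K)"
    proof (cases "x \<le> K + \<theta>")
      case True
      have "K - f x \<le> L2 * (x - K)" using right[of x] True x by auto
      also have "\<dots> \<le> L * (x - K)" using L x by (intro mult_right_mono) auto
      finally show ?thesis .
    next
      case False
      have "K - f x \<le> K / \<theta> * \<theta>" using f_pos[of x] x K_pos \<theta> by simp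
      also have "\<dots> \<le> L * \<theta>" using L \<theta> by (intro mult_right_mono) auto
      also have "\<dots> \<le> L * (x - K)" using L False by (intro mult_left_mono) auto
      finally show ?thesis .
    qed
    hence "(1 - \<beta>) * (K - f x) \<le> (1 - \<beta>) * (L * (x - K))" using \<beta> by (intro mult_left_mono) auto
    also have "\<dots> = \<beta> * (x - K)" by (simp only: mult.assoc[symmetric] eq)
    finally show ?thesis by (simp add: G_def algebra_simps)
  qed
  have f2: "0 \<le> f2_min f K"
    unfolding f2_min_def using below hump
    by (intro cInf_greatest) (auto simp: less_imp_le)
  have "\<beta> \<in> S_set f K"
    unfolding S_set_def
  proof (safe)
    fix x assume x: "x \<in> {f2_min f K<..<K}"
    hence x': "0 < x" "x < K" using f2 by auto
    have g: "G f \<beta> x \<le> K" "x < G f \<beta> x" using left_stays[of x] G_gt_self[of x \<beta>] \<beta> x' by auto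
    have "G f \<beta> x \<le> G f \<beta> (G f \<beta> x)"
      using g x' G_gt_self[of "G f \<beta> x" \<beta>] \<beta> G_equilibrium by (cases "G f \<beta> x = K") auto
    thus "x < G f \<beta> (G f \<beta> x)" using g by simp
  next
    fix x assume x: "x \<in> {K<..<f_max f K}"
    have g: "K \<le> G f \<beta> x" "G f \<beta> x < x" using right_stays[of x] G_lt_self[of x \<beta>] \<beta> x by auto
    have "G f \<beta> (G f \<beta> x) \<le> G f \<beta> x"
      using g G_lt_self[of "G f \<beta> x" \<beta>] \<beta> G_equilibrium by (cases "G f \<beta> x = K") auto
    thus "G f \<beta> (G f \<beta> x) < x" using g by simp
  qed (use \<beta> in auto)
  thus ?thesis by blast
qed

section \<open>Uniform attraction under strong control\<close>

text \<open>
  The upper end is the larger of \<open>x0\<close> and the top of the hump. Left of \<open>K\<close> the map only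
  increases points, and between \<open>K\<close> and the upper end it has a positive minimum; the smaller of
  \<open>x0\<close> and this minimum is the lower end.
\<close>
lemma (in unstable_map) compact_invariant_interval:
  assumes "0 < x0"
  obtains A B where "0 < A" "A \<le> K" "K \<le> B" "x0 \<in> {A..B}" "f ` {A..B} \<subseteq> {A..B}"
proof -
  define B where "B = max x0 (f_max f K)"
  have B: "K \<le> B" "x0 \<le> B" "f_max f K \<le> B"
    using equilibrium_le_f_max by (auto simp: B_def)
  have "\<exists>q\<in>{K..B}. \<forall>x\<in>{K..B}. f q \<le> f x"
    using B K_pos by (intro continuous_attains_inf continuous_on_subset[OF cont]) auto
  then obtain q where q: "q \<in> {K..B}" "\<And>x. x \<in> {K..B} \<Longrightarrow> f q \<le> f x" by blast
  define A where "A = min x0 (f q)"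
  have A: "0 < A" "A \<le> x0" "A \<le> f q"
    using assms f_pos[of q] q K_pos by (auto simp: A_def)
  have "A \<le> K" using A q(2)[of K] B fixed by simp
  have "f x \<in> {A..B}" if x: "x \<in> {A..B}" for x
  proof (cases "x \<le> K")
    case True
    have "x \<le> f x" "f x \<le> f_max f K"
      using f_at_least_self[of x] f_le_f_max[of x] True x A by auto
    thus ?thesis using x B by simp
  next
    case False
    hence "f q \<le> f x" using q(2)[of x] x by simp
    moreover have "f x \<le> x" using f_at_most_self[of x] False by simp
    ultimately show ?thesis using x A by simp
  qed
  hence "f ` {A..B} \<subseteq> {A..B}" by blast
  thus ?thesis using that[of A B] A B \<open>A \<le> K\<close> by simp
qed

lemma G_mem_interval:
  assumes "f x \<in> {A..B}" "x \<in> {A..B}" "0 \<le> \<beta>" "\<beta> \<le> 1"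
  shows "G f \<beta> x \<in> {A..B}"
proof -
  have "(1 - \<beta>) * f x + \<beta> * x \<le> B"
    using assms by (intro convex_bound_le) auto
  moreover have "(1 - \<beta>) * - f x + \<beta> * - x \<le> - A"
    using assms by (intro convex_bound_le) auto
  ultimately show ?thesis by (simp add: G_def)
qed

text \<open>
  The states attainable in exactly \<open>n\<close> steps from \<open>X\<close> when the controller may choose any
  control in \<open>T\<close> anew at each step; this removes the randomness from the global argument.
\<close>
primrec reachable :: "(real \<Rightarrow> real) \<Rightarrow> real set \<Rightarrow> real set \<Rightarrow> nat \<Rightarrow> real set" where
  "reachable f T X 0 = X"
| "reachable f T X (Suc n) = (\<lambda>z. G f (fst z) (snd z)) ` (T \<times> reachable f T X n)"

lemma reachable_antimono:
  assumes "\<And>\<beta> x. \<beta> \<in> T \<Longrightarrow> x \<in> X \<Longrightarrow> G f \<beta> x \<in> X" and "m \<le> n"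
  shows "reachable f T X n \<subseteq> reachable f T X m"
proof -
  have step: "reachable f T X (Suc n) \<subseteq> reachable f T X n" for n
  proof (induction n)
    case 0
    show ?case using assms(1) by auto
  next
    case (Suc n)
    have "reachable f T X (Suc (Suc n))
        = (\<lambda>z. G f (fst z) (snd z)) ` (T \<times> reachable f T X (Suc n))" by (rule reachable.simps)
    also have "\<dots> \<subseteq> (\<lambda>z. G f (fst z) (snd z)) ` (T \<times> reachable f T X n)"
      using Suc.IH by (intro image_mono Sigma_mono) auto
    finally show ?case by simp
  qed
  show ?thesis by (rule lift_Suc_antimono_le[of "reachable f T X", OF step assms(2)])
qed

lemma (in unstable_map) reachable_interval:
  assumes sb: "0 \<le> s" "b \<le> 1" and A: "0 < A" and inv: "f ` {A..B} \<subseteq> {A..B}"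
  shows reachable_interval_antimono:
      "m \<le> n \<Longrightarrow> reachable f {s..b} {A..B} n \<subseteq> reachable f {s..b} {A..B} m"
    and compact_reachable_interval: "compact (reachable f {s..b} {A..B} n)"
    and continuous_on_reachable_interval:
      "continuous_on ({s..b} \<times> reachable f {s..b} {A..B} n) (\<lambda>z. G f (fst z) (snd z))"
proof -
  show antimono: "reachable f {s..b} {A..B} n \<subseteq> reachable f {s..b} {A..B} m" if "m \<le> n" for m n
  proof (rule reachable_antimono[OF _ that])
    fix \<beta> x assume "\<beta> \<in> {s..b}" "x \<in> {A..B}"
    thus "G f \<beta> x \<in> {A..B}" using inv sb by (intro G_mem_interval) (auto simp: image_subset_iff)
  qed
  show contG: "continuous_on ({s..b} \<times> reachable f {s..b} {A..B} n) (\<lambda>z. G f (fst z) (snd z))" for n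
    using antimono[of 0 n] A by (intro continuous_on_subset[OF continuous_on_G]) auto
  show "compact (reachable f {s..b} {A..B} n)" for n
  proof (induction n)
    case (Suc n)
    thus ?case unfolding reachable.simps by (intro compact_continuous_image contG compact_Times) auto
  qed simp
qed

text \<open>
  The intersection \<open>C'\<close> is compact and every point of it is the image of a point of \<open>C'\<close>
  under an admissible control. Its minimum \<open>m\<close> must come from a point \<open>q\<close> right of \<open>K\<close> and its
  maximum \<open>M\<close> from a point \<open>p\<close> left of \<open>K\<close>, since a controlled step moves every point strictly
  in the direction of \<open>K\<close>. Replacing the controls used by the weakest one, \<open>s\<close>, only lengthens these jumps, so
  \<open>p\<close> and \<open>q\<close> violate \<open>no_swap_if_mem_S_set\<close> unless \<open>m = M = K\<close>.
\<close>
lemma (in unstable_map) reachable_shrinks_to_equilibrium: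
  assumes s: "s \<in> S_set f K" and sb: "s \<le> b" "b < 1"
    and A: "0 < A" "A \<le> K" "K \<le> B" and inv: "f ` {A..B} \<subseteq> {A..B}"
  shows "(\<Inter>n. reachable f {s..b} {A..B} n) = {K}"
proof -
  define C where "C = reachable f {s..b} {A..B}"
  define C' where "C' = (\<Inter>n. C n)"
  have s0: "0 < s" using s by (simp add: S_set_def)
  have C_simps: "C 0 = {A..B}" "C (Suc n) = (\<lambda>z. G f (fst z) (snd z)) ` ({s..b} \<times> C n)" for n
    by (simp_all add: C_def)
  have antimono: "C n \<subseteq> C m" if "m \<le> n" for m n
    unfolding C_def using that s0 sb by (intro reachable_interval_antimono A inv) auto
  have comp: "compact (C n)" for n
    unfolding C_def using s0 sb by (intro compact_reachable_interval A inv) auto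
  have contG: "continuous_on ({s..b} \<times> C n) (\<lambda>z. G f (fst z) (snd z))" for n
    unfolding C_def using s0 sb by (intro continuous_on_reachable_interval A inv) auto
  have C_sub: "C n \<subseteq> {A..B}" for n using antimono[of 0 n] by (simp add: C_simps)
  have K_in: "K \<in> C n" for n
  proof (induction n)
    case (Suc n)
    have "K = G f s K" by (simp add: G_equilibrium)
    thus ?case unfolding C_simps using Suc sb by force
  qed (use A in \<open>simp add: C_simps\<close>)
  \<comment> \<open>Compactness turns membership in every \<open>C n\<close> into a preimage in the intersection itself.\<close>
  have preimage: "\<exists>\<beta>\<in>{s..b}. \<exists>q\<in>C'. y = G f \<beta> q" if y: "y \<in> C'" for y
  proof -
    define Z where "Z n = {z \<in> {s..b} \<times> C n. G f (fst z) (snd z) = y}" for n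
    have "\<Inter> (range Z) \<noteq> {}"
    proof (rule compact_nest)
      fix n
      have Z_eq: "Z n = ({s..b} \<times> C n) \<inter> (\<lambda>z. G f (fst z) (snd z)) -` {y}" by (auto simp: Z_def)
      have comp2: "compact ({s..b} \<times> C n)" by (intro compact_Times comp compact_Icc)
      have "closed (Z n)" unfolding Z_eq
        by (intro continuous_closed_preimage contG compact_imp_closed comp2 closed_singleton)
      hence "compact (({s..b} \<times> C n) \<inter> Z n)" by (intro compact_Int_closed comp2)
      moreover have "({s..b} \<times> C n) \<inter> Z n = Z n" unfolding Z_eq by blast
      ultimately show "compact (Z n)" by simp
      have "y \<in> C (Suc n)" using y by (auto simp: C'_def)
      thus "Z n \<noteq> {}" unfolding C_simps Z_def by blast
    next
      fix m n :: nat assume "m \<le> n"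
      thus "Z n \<subseteq> Z m" using antimono[of m n] by (auto simp: Z_def)
    qed
    then obtain z where z: "\<And>n. z \<in> Z n" by blast
    have "fst z \<in> {s..b}" "G f (fst z) (snd z) = y" using z[of 0] by (auto simp: Z_def)
    moreover have "snd z \<in> C n" for n using z[of n] by (auto simp: Z_def)
    hence "snd z \<in> C'" by (simp add: C'_def)
    ultimately show ?thesis by blast
  qed
  have "compact C'"
    unfolding C'_def by (intro compact_Inter) (auto simp: comp)
  moreover have K_C': "K \<in> C'" using K_in by (auto simp: C'_def)
  ultimately have "\<exists>m\<in>C'. \<forall>x\<in>C'. m \<le> x" "\<exists>M\<in>C'. \<forall>x\<in>C'. x \<le> M"
    by (blast intro: compact_attains_inf compact_attains_sup)+
  then obtain m M where m: "m \<in> C'" "\<And>x. x \<in> C' \<Longrightarrow> m \<le> x"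
    and M: "M \<in> C'" "\<And>x. x \<in> C' \<Longrightarrow> x \<le> M" by blast
  have C'_sub: "C' \<subseteq> {A..B}" using C_sub by (auto simp: C'_def)
  have mM: "m \<le> K" "K \<le> M" using m(2) M(2) K_C' by blast+
  obtain \<beta> q where q: "\<beta> \<in> {s..b}" "q \<in> C'" "m = G f \<beta> q" using preimage m(1) by blast
  obtain \<gamma> p where p: "\<gamma> \<in> {s..b}" "p \<in> C'" "M = G f \<gamma> p" using preimage M(1) by blast
  have bounds: "m \<le> q" "q \<le> M" "m \<le> p" "p \<le> M" using m(2) M(2) q(2) p(2) by blast+
  have "A \<le> m" using m(1) C'_sub by auto
  hence pos: "0 < m" "0 < p" "0 < q" using A bounds by auto
  have q_right: "q \<le> K \<Longrightarrow> m = K"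
    using G_gt_self[of q \<beta>] q bounds pos sb G_equilibrium[of \<beta>] mM by (cases "q = K") auto
  have p_left: "K \<le> p \<Longrightarrow> M = K"
    using G_lt_self[of p \<gamma>] p bounds pos sb G_equilibrium[of \<gamma>] mM by (cases "p = K") auto
  have "m = K \<and> M = K"
  proof (cases "m = K \<or> M = K")
    case True
    thus ?thesis using q_right p_left bounds by auto
  next
    case False
    hence pq: "p < K" "K < q" using q_right p_left by (meson not_le)+
    have "M \<le> G f s p" using G_mono_control_left[of p s \<gamma>] p bounds pos pq by auto
    moreover have "G f s q \<le> m" using G_mono_control_right[of q s \<beta>] q pq by auto
    ultimately show ?thesis
      using no_swap_if_mem_S_set[OF s, of p q] bounds pos pq by auto
  qed
  hence "C' \<subseteq> {K}" using m(2) M(2) by (metis antisym subsetI singletonI)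
  thus ?thesis using K_C' by (auto simp: C'_def C_def)
qed

lemma (in unstable_map) uniform_attraction:
  assumes s: "s \<in> S_set f K" and sb: "s \<le> b" "b < 1"
    and A: "0 < A" "A \<le> K" "K \<le> B" and inv: "f ` {A..B} \<subseteq> {A..B}"
    and \<delta>: "0 < \<delta>"
  shows "\<exists>N. \<forall>x \<in> reachable f {s..b} {A..B} N. \<bar>x - K\<bar> < \<delta>"
proof -
  define F where "F n = reachable f {s..b} {A..B} n \<inter> - ball K \<delta>" for n
  have s0: "0 \<le> s" "b \<le> 1" using s sb by (auto simp: S_set_def)
  have "\<exists>n. F n = {}"
  proof (rule ccontr)
    assume "\<nexists>n. F n = {}"
    moreover have "compact (F n)" for n
      unfolding F_def
      by (intro compact_Int_closed compact_reachable_interval[OF s0 A(1) inv]) auto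
    moreover have "F n \<subseteq> F m" if "m \<le> n" for m n
      unfolding F_def using reachable_interval_antimono[OF s0 A(1) inv that] by blast
    ultimately have "\<Inter> (range F) \<noteq> {}" by (intro compact_nest) auto
    moreover have "\<Inter> (range F) = (\<Inter>n. reachable f {s..b} {A..B} n) - ball K \<delta>"
      by (auto simp: F_def)
    ultimately show False
      using reachable_shrinks_to_equilibrium[OF s sb A inv] \<delta> by simp
  qed
  then obtain N where "F N = {}" by blast
  hence "x \<in> ball K \<delta>" if "x \<in> reachable f {s..b} {A..B} N" for x
    using that by (auto simp: F_def)
  thus ?thesis by (intro exI[of _ N] ballI) (simp add: dist_real_def abs_minus_commute)
qed

lemma orbit_mem_reachable:
  assumes "y 0 \<in> X" "\<And>n. n < N \<Longrightarrow> \<beta> n \<in> T" "\<And>n. n < N \<Longrightarrow> y (Suc n) = G f (\<beta> n) (y n)"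
  shows "y N \<in> reachable f T X N"
  using assms
proof (induction N)
  case (Suc N)
  thus ?case by (auto simp: image_iff intro!: bexI[of _ "(\<beta> N, y N)"])
qed simp

section \<open>Alternating contraction near the equilibrium\<close>

text \<open>
  The parity of the time, shifted by \<open>c\<close>, tells the side of \<open>K\<close>. The drift bound on the
  log-factors \<open>Z\<close> has two uses: the part \<open>C\<close> keeps the orbit within \<open>\<theta>\<close> of \<open>K\<close>, where the step
  estimates are valid, and the part \<open>r\<close> makes the distance decay geometrically.
\<close>
lemma alternating_contraction:
  fixes y Z :: "nat \<Rightarrow> real" and K \<theta> C r :: real and n0 c :: nat
  assumes left: "\<And>n. n0 \<le> n \<Longrightarrow> even (Suc n + c) \<Longrightarrow> K - \<theta> < y n \<Longrightarrow> y n \<le> K \<Longrightarrow>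
        K \<le> y (Suc n) \<and> y (Suc n) - K \<le> exp (Z (Suc n)) * (K - y n)"
    and right: "\<And>n. n0 \<le> n \<Longrightarrow> odd (Suc n + c) \<Longrightarrow> K \<le> y n \<Longrightarrow> y n < K + \<theta> \<Longrightarrow>
        y (Suc n) \<le> K \<and> K - y (Suc n) \<le> exp (Z (Suc n)) * (y n - K)"
    and start: "if even (Suc n0 + c) then y n0 \<le> K else K \<le> y n0"
    and close: "\<bar>y n0 - K\<bar> < \<theta> * exp (- C)"
    and r: "0 < r"
    and sums: "\<And>k. (\<Sum>i\<in>{n0<..n0 + k}. Z i) \<le> C - r * real k"
  shows "y \<longlonglongrightarrow> K"
proof -
  define D where "D = \<bar>y n0 - K\<bar>"
  have D: "0 \<le> D" "D * exp C < \<theta>"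
    using close by (auto simp: D_def exp_minus field_simps)
  have bound: "D * exp (\<Sum>i\<in>{n0<..n0 + k}. Z i) \<le> D * exp C * exp (- r) ^ k" for k
  proof -
    have "exp (\<Sum>i\<in>{n0<..n0 + k}. Z i) \<le> exp (C + real k * - r)"
      using sums[of k] by (simp add: algebra_simps)
    also have "\<dots> = exp C * exp (- r) ^ k" by (simp only: exp_add exp_of_nat_mult)
    finally have "D * exp (\<Sum>i\<in>{n0<..n0 + k}. Z i) \<le> D * (exp C * exp (- r) ^ k)"
      using D(1) by (rule mult_left_mono)
    thus ?thesis by (simp add: mult.assoc)
  qed
  have main: "(if even (Suc (n0 + k) + c) then y (n0 + k) \<le> K else K \<le> y (n0 + k)) \<and>
      \<bar>y (n0 + k) - K\<bar> \<le> D * exp (\<Sum>i\<in>{n0<..n0 + k}. Z i)" for k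
  proof (induction k)
    case 0
    show ?case using start by (simp add: D_def)
  next
    case (Suc k)
    define n where "n = n0 + k"
    define S where "S = (\<Sum>i\<in>{n0<..n}. Z i)"
    have IH: "if even (Suc n + c) then y n \<le> K else K \<le> y n" "\<bar>y n - K\<bar> \<le> D * exp S"
      using Suc by (simp_all add: n_def S_def)
    have "D * exp C * exp (- r) ^ k \<le> D * exp C * 1"
      using D(1) r by (intro mult_left_mono power_le_one) auto
    hence near: "\<bar>y n - K\<bar> < \<theta>" using IH(2) bound[of k] D(2) by (simp add: n_def S_def)
    have next_step: "(if even (Suc n + c) then K \<le> y (Suc n) else y (Suc n) \<le> K)
        \<and> \<bar>y (Suc n) - K\<bar> \<le> exp (Z (Suc n)) * \<bar>y n - K\<bar>"
      using left[of n] right[of n] IH(1) near by (auto simp: n_def split: if_splits)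
    have "{n0<..Suc n} = insert (Suc n) {n0<..n}" by (auto simp: n_def)
    hence sum_Suc: "(\<Sum>i\<in>{n0<..Suc n}. Z i) = Z (Suc n) + S" by (simp add: S_def)
    have "\<bar>y (Suc n) - K\<bar> \<le> exp (Z (Suc n)) * (D * exp S)"
      using next_step IH(2) by (meson exp_ge_zero mult_left_mono order_trans)
    also have "\<dots> = D * exp (\<Sum>i\<in>{n0<..Suc n}. Z i)" by (simp add: sum_Suc exp_add)
    finally have close_Suc: "\<bar>y (Suc n) - K\<bar> \<le> D * exp (\<Sum>i\<in>{n0<..Suc n}. Z i)" .
    have "n0 + Suc k = Suc n" by (simp add: n_def)
    thus ?case using next_step close_Suc by (simp split: if_splits)
  qed
  have "(\<lambda>k. y (n0 + k) - K) \<longlonglongrightarrow> 0"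
  proof (rule Lim_null_comparison)
    show "eventually (\<lambda>k. norm (y (n0 + k) - K) \<le> D * exp C * exp (- r) ^ k) sequentially"
      using main bound order_trans by (intro always_eventually allI) (simp, blast)
    have "(\<lambda>k. exp (- r) ^ k) \<longlonglongrightarrow> 0" using r by (intro LIMSEQ_power_zero) auto
    thus "(\<lambda>k. D * exp C * exp (- r) ^ k) \<longlonglongrightarrow> 0" by (rule tendsto_mult_right_zero)
  qed
  hence "(\<lambda>k. y (k + n0)) \<longlonglongrightarrow> K" by (simp add: LIM_zero_iff add.commute)
  thus ?thesis by (rule LIMSEQ_offset)
qed

text \<open>
  The control \<open>a / (a + 1)\<close> is the one at which a line of slope \<open>- a\<close> through the equilibrium
  is flattened to slope zero; below it, steps still overshoot.
\<close>
lemma control_threshold: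
  fixes a :: real
  assumes "0 < a" "\<beta> \<le> a / (a + 1)"
  shows "\<beta> < 1" "\<beta> \<le> (1 - \<beta>) * a"
proof -
  show "\<beta> \<le> (1 - \<beta>) * a" using assms by (simp add: field_simps)
  have "a / (a + 1) < 1" using assms by simp
  thus "\<beta> < 1" using assms by linarith
qed

lemma ctrl_slope_pos:
  assumes "0 < a" "a < L" "\<beta> \<le> a / (a + 1)"
  shows "0 < ctrl_slope L \<beta>"
proof -
  note th = control_threshold[OF assms(1,3)]
  have "(1 - \<beta>) * a < (1 - \<beta>) * L" using th assms by simp
  thus ?thesis using th(2) unfolding ctrl_slope_def by linarith
qed

lemma ctrl_slope_antimono: "0 \<le> L \<Longrightarrow> \<beta> \<le> \<gamma> \<Longrightarrow> ctrl_slope L \<gamma> \<le> ctrl_slope L \<beta>"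
  using mult_right_mono[of "1 - \<gamma>" "1 - \<beta>" L] by (simp add: ctrl_slope_def)

lemma G_crosses_from_left:
  assumes "0 < a" "\<beta> \<le> a / (a + 1)" "x < K"
    and "f x > a * (K - x) + K" and "f x - K \<le> L * (K - x)"
  shows "K \<le> G f \<beta> x" "G f \<beta> x - K \<le> ctrl_slope L \<beta> * (K - x)"
proof -
  note th = control_threshold[OF assms(1,2)]
  have "\<beta> * (K - x) \<le> (1 - \<beta>) * a * (K - x)" using th assms by (intro mult_right_mono) auto
  moreover have "(1 - \<beta>) * (a * (K - x)) \<le> (1 - \<beta>) * (f x - K)"
    using th assms by (intro mult_left_mono) auto
  moreover have "(1 - \<beta>) * (f x - K) \<le> (1 - \<beta>) * (L * (K - x))"
    using th assms by (intro mult_left_mono) auto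
  ultimately show "K \<le> G f \<beta> x" "G f \<beta> x - K \<le> ctrl_slope L \<beta> * (K - x)"
    by (simp_all add: G_def ctrl_slope_def algebra_simps)
qed

lemma G_crosses_from_right:
  assumes "0 < a" "\<beta> \<le> a / (a + 1)" "K < x"
    and "f x < a * (K - x) + K" and "K - f x \<le> L * (x - K)"
  shows "G f \<beta> x \<le> K" "K - G f \<beta> x \<le> ctrl_slope L \<beta> * (x - K)"
proof -
  note th = control_threshold[OF assms(1,2)]
  have "\<beta> * (x - K) \<le> (1 - \<beta>) * a * (x - K)" using th assms by (intro mult_right_mono) auto
  moreover have "(1 - \<beta>) * (a * (x - K)) \<le> (1 - \<beta>) * (K - f x)"
    using th assms by (intro mult_left_mono) (auto simp: algebra_simps)
  moreover have "(1 - \<beta>) * (K - f x) \<le> (1 - \<beta>) * (L * (x - K))"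
    using th assms by (intro mult_left_mono) auto
  ultimately show "G f \<beta> x \<le> K" "K - G f \<beta> x \<le> ctrl_slope L \<beta> * (x - K)"
    by (simp_all add: G_def ctrl_slope_def algebra_simps)
qed

lemma noisy_orbit_Suc_eq_G:
  "noisy_orbit f \<alpha> l z x0 (Suc n) = G f (\<alpha> + l * z (Suc n)) (noisy_orbit f \<alpha> l z x0 n)"
  by (simp add: G_def algebra_simps)

lemma noisy_orbit_mem_invariant_interval:
  assumes "x0 \<in> {A..B}" "f ` {A..B} \<subseteq> {A..B}"
    and "\<And>i. 1 \<le> i \<Longrightarrow> \<alpha> + l * z i \<in> {0..1}"
  shows "noisy_orbit f \<alpha> l z x0 n \<in> {A..B}"
proof (induction n)
  case (Suc n)
  hence "f (noisy_orbit f \<alpha> l z x0 n) \<in> {A..B}" using assms(2) by blast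
  thus ?case unfolding noisy_orbit_Suc_eq_G
    using Suc assms(3)[of "Suc n"] by (intro G_mem_interval) auto
qed (use assms in simp)

text \<open>
  The factor for the distance to \<open>K\<close> at time \<open>i\<close> is \<open>ctrl_slope Lm\<close> or \<open>ctrl_slope Lp\<close>,
  according to the side that the step leaves; it may exceed \<open>1\<close>, and only the drift of the
  logarithms makes the orbit contract. Which of the two parity patterns occurs depends on the side visited at time \<open>n0\<close>,
  hence on the past, so the drift is required of both patterns.
\<close>
lemma (in unstable_map) noisy_orbit_tendsto_equilibrium:
  fixes \<theta> Lm Lp a1 a2 \<alpha> l C r x0 :: real and z :: "nat \<Rightarrow> real"
  defines "x \<equiv> noisy_orbit f \<alpha> l z x0"
    and "\<beta> \<equiv> (\<lambda>i. \<alpha> + l * z i)"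
  assumes a: "0 < a1" "a1 < Lm" "0 < a2" "a2 < Lp"
    and upper_left: "\<And>x. x \<in> {K - \<theta>..K} \<Longrightarrow> f x - K \<le> Lm * (K - x)"
    and lower_right: "\<And>x. x \<in> {K..K + \<theta>} \<Longrightarrow> K - f x \<le> Lp * (x - K)"
    and lower_left: "\<And>x. x \<in> {K - \<theta><..<K} \<Longrightarrow> f x > a1 * (K - x) + K"
    and upper_right: "\<And>x. x \<in> {K<..<K + \<theta>} \<Longrightarrow> f x < a2 * (K - x) + K"
    and \<beta>_le: "\<And>i. 1 \<le> i \<Longrightarrow> \<beta> i \<le> a1 / (a1 + 1)" "\<And>i. 1 \<le> i \<Longrightarrow> \<beta> i \<le> a2 / (a2 + 1)"
    and close: "\<bar>x n0 - K\<bar> < \<theta> * exp (- C)" and r: "0 < r"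
    and sums: "\<And>c k. c \<in> {0, 1} \<Longrightarrow> (\<Sum>i\<in>{n0<..n0 + k}.
        ln (ctrl_slope (if even (i + c) then Lm else Lp) (\<beta> i))) \<le> C - r * real k"
  shows "x \<longlonglongrightarrow> K"
proof -
  \<comment> \<open>The parity \<open>c\<close> is chosen so that the visit at time \<open>n0\<close> is to the side assigned to it.\<close>
  define c :: nat where "c = (if x n0 \<le> K \<longleftrightarrow> odd n0 then 0 else 1)"
  have x_Suc: "x (Suc n) = G f (\<beta> (Suc n)) (x n)" for n
    unfolding x_def \<beta>_def by (rule noisy_orbit_Suc_eq_G)
  show ?thesis
  proof (rule alternating_contraction)
    fix n assume *: "even (Suc n + c)" "K - \<theta> < x n" "x n \<le> K"
    have "0 < ctrl_slope Lm (\<beta> (Suc n))" using a \<beta>_le by (intro ctrl_slope_pos[of a1]) auto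
    hence eq: "exp (ln (ctrl_slope (if even (Suc n + c) then Lm else Lp) (\<beta> (Suc n))))
        = ctrl_slope Lm (\<beta> (Suc n))" using * by simp
    show "K \<le> x (Suc n) \<and> x (Suc n) - K
        \<le> exp (ln (ctrl_slope (if even (Suc n + c) then Lm else Lp) (\<beta> (Suc n)))) * (K - x n)"
    proof (cases "x n = K")
      case True
      thus ?thesis by (simp add: x_Suc G_equilibrium)
    next
      case False
      hence lt: "x n < K" using * by simp
      have "f (x n) > a1 * (K - x n) + K" using * lt by (intro lower_left) auto
      moreover have "f (x n) - K \<le> Lm * (K - x n)" using * by (intro upper_left) auto
      ultimately show ?thesis unfolding eq x_Suc
        using G_crosses_from_left[OF a(1) \<beta>_le(1)[of "Suc n"] lt] by simp
    qed
  next
    fix n assume *: "odd (Suc n + c)" "K \<le> x n" "x n < K + \<theta>"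
    have "0 < ctrl_slope Lp (\<beta> (Suc n))" using a \<beta>_le by (intro ctrl_slope_pos[of a2]) auto
    hence eq: "exp (ln (ctrl_slope (if even (Suc n + c) then Lm else Lp) (\<beta> (Suc n))))
        = ctrl_slope Lp (\<beta> (Suc n))" using * by simp
    show "x (Suc n) \<le> K \<and> K - x (Suc n)
        \<le> exp (ln (ctrl_slope (if even (Suc n + c) then Lm else Lp) (\<beta> (Suc n)))) * (x n - K)"
    proof (cases "x n = K")
      case True
      thus ?thesis by (simp add: x_Suc G_equilibrium)
    next
      case False
      hence gt: "K < x n" using * by simp
      have "f (x n) < a2 * (K - x n) + K" using * gt by (intro upper_right) auto
      moreover have "K - f (x n) \<le> Lp * (x n - K)" using * by (intro lower_right) auto
      ultimately show ?thesis unfolding eq x_Suc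
        using G_crosses_from_right[OF a(3) \<beta>_le(2)[of "Suc n"] gt] by simp
    qed
  next
    show "if even (Suc n0 + c) then x n0 \<le> K else K \<le> x n0" by (auto simp: c_def)
    show "(\<Sum>i\<in>{n0<..n0 + k}. ln (ctrl_slope (if even (i + c) then Lm else Lp) (\<beta> i)))
        \<le> C - r * real k" for k
      by (rule sums) (simp add: c_def)
  qed (use close r in auto)
qed

section \<open>Events of the future noise\<close>

text \<open>
  As a measure space rather than a bare set of events, so that measurability of functions of
  the noise with respect to a block of indices is available.
\<close>
definition (in iid_noise) noise_algebra :: "nat set \<Rightarrow> 'a measure" where
  "noise_algebra J = sigma (space M) (\<Union>i\<in>J. {\<xi> i -` S \<inter> space M | S. S \<in> sets borel})"

lemma (in iid_noise) space_noise_algebra [simp]: "space (noise_algebra J) = space M"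
  unfolding noise_algebra_def by (intro space_measure_of) auto

lemma (in iid_noise) sets_noise_algebra:
  "sets (noise_algebra J) = sigma_sets (space M) (\<Union>i\<in>J. {\<xi> i -` S \<inter> space M | S. S \<in> sets borel})"
  unfolding noise_algebra_def by (intro sets_measure_of) auto

lemma (in iid_noise) random_variable_noise: "1 \<le> i \<Longrightarrow> random_variable borel (\<xi> i)"
  using indep by (auto simp: indep_vars_def2)

lemma (in iid_noise) measurable_noise_algebra:
  assumes "i \<in> J" shows "\<xi> i \<in> borel_measurable (noise_algebra J)"
proof (rule measurableI)
  fix S :: "real set" assume "S \<in> sets borel"
  thus "\<xi> i -` S \<inter> space (noise_algebra J) \<in> sets (noise_algebra J)"
    using assms unfolding sets_noise_algebra by (auto intro!: sigma_sets.Basic)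
qed simp

lemma (in iid_noise) noise_algebra_mono:
  assumes "A \<in> sets (noise_algebra I)" "I \<subseteq> J" shows "A \<in> sets (noise_algebra J)"
proof -
  have "sets (noise_algebra I) \<subseteq> sets (noise_algebra J)"
    unfolding sets_noise_algebra using assms(2) by (intro sigma_sets_subseteq UN_mono) auto
  thus ?thesis using assms(1) by blast
qed

lemma (in iid_noise) sets_noise_algebra_events:
  assumes "J \<subseteq> {1..}" shows "sets (noise_algebra J) \<subseteq> events"
  unfolding sets_noise_algebra
proof (rule sets.sigma_sets_subset)
  show "(\<Union>i\<in>J. {\<xi> i -` S \<inter> space M | S. S \<in> sets borel}) \<subseteq> events"
    using assms random_variable_noise by (auto intro!: measurable_sets)
qed

lemma (in iid_noise) indep_generators:
  "indep_sets (\<lambda>i. {\<xi> i -` S \<inter> space M | S. S \<in> sets borel}) {1..}"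
  using indep by (simp add: indep_vars_def2)

lemma Int_stable_vimages: "Int_stable {X -` S \<inter> \<Omega> | S. S \<in> sets N}"
proof (rule Int_stableI)
  fix a b assume "a \<in> {X -` S \<inter> \<Omega> | S. S \<in> sets N}" "b \<in> {X -` S \<inter> \<Omega> | S. S \<in> sets N}"
  then obtain S T where "S \<in> sets N" "T \<in> sets N" "a = X -` S \<inter> \<Omega>" "b = X -` T \<inter> \<Omega>" by blast
  thus "a \<inter> b \<in> {X -` S \<inter> \<Omega> | S. S \<in> sets N}" by (auto intro!: exI[of _ "S \<inter> T"])
qed

lemma (in iid_noise) prob_Int_disjoint_times:
  assumes IJ: "I \<subseteq> {1..}" "J \<subseteq> {1..}" "I \<inter> J = {}"
    and a: "a \<in> sets (noise_algebra I)" and b: "b \<in> sets (noise_algebra J)"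
  shows "prob (a \<inter> b) = prob a * prob b"
proof -
  have "indep_sets (\<lambda>j. sigma_sets (space M)
      (\<Union>i\<in>case_bool I J j. {\<xi> i -` S \<inter> space M | S. S \<in> sets borel})) UNIV"
  proof (rule indep_sets_collect_sigma)
    show "indep_sets (\<lambda>i. {\<xi> i -` S \<inter> space M | S. S \<in> sets borel}) (\<Union>j. case_bool I J j)"
      by (rule indep_sets_mono_index[OF _ indep_generators]) (use IJ in \<open>auto split: bool.splits\<close>)
    show "disjoint_family (case_bool I J)"
      using IJ by (auto simp: disjoint_family_on_def split: bool.splits)
  qed (rule Int_stable_vimages)
  hence "indep_set (sets (noise_algebra I)) (sets (noise_algebra J))"
    unfolding indep_set_def sets_noise_algebra
    by (rule indep_sets_mono_sets) (auto split: bool.splits)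
  thus ?thesis using a b by (rule indep_setD)
qed

lemma (in iid_noise) prob_noise_block_near_one:
  "prob {\<omega> \<in> space M. \<forall>i\<in>{m<..m + N}. \<xi> i \<omega> \<in> {1 - \<epsilon><..1}}
     = prob {\<omega> \<in> space M. \<xi> 1 \<omega> \<in> {1 - \<epsilon><..1}} ^ N"
proof (cases "N = 0")
  case True
  thus ?thesis by (simp add: prob_space)
next
  case False
  let ?S = "{1 - \<epsilon><..1} :: real set"
  have "{\<omega> \<in> space M. \<forall>i\<in>{m<..m + N}. \<xi> i \<omega> \<in> ?S} = (\<Inter>i\<in>{m<..m + N}. \<xi> i -` ?S \<inter> space M)"
    using False by auto
  also have "prob \<dots> = (\<Prod>i\<in>{m<..m + N}. prob (\<xi> i -` ?S \<inter> space M))"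
    by (rule indep_varsD[OF indep]) (use False in auto)
  also have "\<dots> = (\<Prod>i\<in>{m<..m + N}. prob (\<xi> 1 -` ?S \<inter> space M))"
  proof (rule prod.cong)
    fix i assume "i \<in> {m<..m + N}"
    hence i: "1 \<le> i" by auto
    have "prob (\<xi> i -` ?S \<inter> space M) = measure (distr M borel (\<xi> i)) ?S"
      using random_variable_noise[OF i] by (simp add: measure_distr)
    also have "\<dots> = measure (distr M borel (\<xi> 1)) ?S" using ident[OF i] by simp
    also have "\<dots> = prob (\<xi> 1 -` ?S \<inter> space M)"
      using random_variable_noise[of 1] by (simp add: measure_distr)
    finally show "prob (\<xi> i -` ?S \<inter> space M) = prob (\<xi> 1 -` ?S \<inter> space M)" .
  qed simp
  also have "\<dots> = prob (\<xi> 1 -` ?S \<inter> space M) ^ N" by simp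
  also have "\<xi> 1 -` ?S \<inter> space M = {\<omega> \<in> space M. \<xi> 1 \<omega> \<in> ?S}" by auto
  finally show ?thesis .
qed

text \<open>
  That infinitely many of the \<open>A m\<close> occur has probability at least \<open>q\<close>, as a decreasing limit
  of unions each containing one of them, and it is a tail event because \<open>A m\<close> looks only at times
  after \<open>m\<close>. The zero-one law replaces an argument with conditional probabilities given the past.
\<close>
lemma (in iid_noise) AE_some_future_event:
  assumes A: "\<And>m. A m \<in> sets (noise_algebra {m<..})"
    and q: "0 < q" "\<And>m. q \<le> prob (A m)"
  shows "AE \<omega> in M. \<exists>m. \<omega> \<in> A m"
proof -
  define U where "U k = (\<Union>m\<in>{k..}. A m)" for k
  have decU: "decseq U" unfolding U_def decseq_def by (intro allI impI UN_mono) auto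
  have U_sets: "U k \<in> sets (noise_algebra {k<..})" for k
    unfolding U_def
  proof (rule sets.countable_UN''[OF countableI_type])
    fix m assume "m \<in> {k..}"
    thus "A m \<in> sets (noise_algebra {k<..})"
      by (intro noise_algebra_mono[OF A]) auto
  qed
  have U_events: "U k \<in> events" for k
  proof -
    have "{k<..} \<subseteq> {1..}" by auto
    thus ?thesis using U_sets[of k] sets_noise_algebra_events[of "{k<..}"] by blast
  qed
  define F where "F i = sigma_sets (space M) {\<xi> (Suc i) -` S \<inter> space M | S. S \<in> sets borel}" for i
  \<comment> \<open>The noise starts at index \<open>1\<close>, the zero-one law at index \<open>0\<close>; hence the shift in \<open>F\<close>.\<close>
  have "prob (\<Inter>k. U k) = 0 \<or> prob (\<Inter>k. U k) = 1"
  proof (rule kolmogorov_0_1_law)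
    show "sigma_algebra (space M) (F i)" for i
      unfolding F_def by (rule sigma_algebra_sigma_sets) auto
    have "indep_sets (\<lambda>i. sigma_sets (space M) {\<xi> i -` S \<inter> space M | S. S \<in> sets borel}) {1..}"
      using indep by (simp add: indep_vars_def)
    note ind = this[unfolded indep_sets_def]
    show "indep_sets F UNIV"
      unfolding indep_sets_def
    proof (intro conjI ballI allI impI)
      fix i show "F i \<subseteq> events" using ind unfolding F_def by auto
    next
      fix J B assume J: "J \<noteq> {}" "finite J" and B: "B \<in> Pi J F"
      have "(\<lambda>j. B (j - 1)) \<in> (\<Pi> i\<in>Suc ` J.
          sigma_sets (space M) {\<xi> i -` S \<inter> space M | S. S \<in> sets borel})"
        using B by (auto simp: F_def Pi_iff)
      hence "prob (\<Inter>j\<in>Suc ` J. B (j - 1)) = (\<Prod>j\<in>Suc ` J. prob (B (j - 1)))"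
        using J by (intro ind[THEN conjunct2, rule_format]) auto
      thus "prob (\<Inter>j\<in>J. B j) = (\<Prod>j\<in>J. prob (B j))"
        by (simp add: prod.reindex)
    qed
    have "(\<Inter>k. U k) \<in> sigma_sets (space M) (\<Union> (F ` {n..}))" for n
    proof -
      have "(\<Inter>k. U k) = (\<Inter>k\<in>{n..}. U k)"
      proof (intro equalityI INT_greatest)
        fix k
        have "(\<Inter>k\<in>{n..}. U k) \<subseteq> U (max k n)" by auto
        also have "\<dots> \<subseteq> U k" by (rule decseqD[OF decU]) simp
        finally show "(\<Inter>k\<in>{n..}. U k) \<subseteq> U k" .
      qed auto
      also have "\<dots> \<in> sets (noise_algebra {n<..})"
      proof (rule sets.countable_INT')
        show "U ` {n..} \<subseteq> sets (noise_algebra {n<..})"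
        proof (rule image_subsetI)
          fix k assume "k \<in> {n..}"
          thus "U k \<in> sets (noise_algebra {n<..})"
            by (intro noise_algebra_mono[OF U_sets]) auto
        qed
      qed auto
      also have "\<dots> \<subseteq> sigma_sets (space M) (\<Union> (F ` {n..}))"
        unfolding sets_noise_algebra
      proof (rule sigma_sets_subseteq, safe)
        fix i and S :: "real set" assume i: "n < i" and S: "S \<in> sets borel"
        then obtain j where j: "i = Suc j" "n \<le> j" by (cases i) auto
        have "\<xi> i -` S \<inter> space M \<in> F j" unfolding F_def j using S by (intro sigma_sets.Basic) auto
        thus "\<xi> i -` S \<inter> space M \<in> \<Union> (F ` {n..})" using j by auto
      qed
      finally show ?thesis .
    qed
    thus "(\<Inter>k. U k) \<in> tail_events F" by (simp add: tail_events_def)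
  qed
  moreover have "q \<le> prob (\<Inter>k. U k)"
  proof (rule LIMSEQ_le_const)
    show "(\<lambda>k. prob (U k)) \<longlonglongrightarrow> prob (\<Inter>k. U k)"
      using U_events by (intro finite_Lim_measure_decseq decU) auto
    have "prob (A k) \<le> prob (U k)" for k
      using U_events by (intro finite_measure_mono) (auto simp: U_def)
    thus "\<exists>N. \<forall>k\<ge>N. q \<le> prob (U k)" using q(2) order_trans by blast
  qed
  ultimately have "prob (\<Inter>k. U k) = 1" using q(1) by auto
  hence "AE \<omega> in M. \<omega> \<in> (\<Inter>k. U k)" by (rule AE_prob_1)
  thus ?thesis by eventually_elim (auto simp: U_def)
qed

section \<open>Negative drift of alternating sums\<close>

text \<open>
  Hoeffding's inequality bounds the probability that the sum over a block of length \<open>k\<close>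
  exceeds its mean by \<open>E + r * k\<close> by \<open>exp (- 2 * (E + r * k)\<^sup>2 / (k * (b - a)\<^sup>2))\<close>. Keeping the
  cross term and the last square of \<open>(E + r * k)\<^sup>2\<close> leaves a geometric series in \<open>k\<close> with a prefactor
  that decays exponentially in \<open>E\<close>, so a large \<open>E\<close> pushes the union bound below any \<open>p\<close>.
\<close>
lemma (in prob_space) uniform_negative_drift:
  fixes Z :: "nat \<Rightarrow> 'a \<Rightarrow> real"
  assumes ind: "indep_vars (\<lambda>_. borel) Z {1..}"
    and bnd: "\<And>i \<omega>. 1 \<le> i \<Longrightarrow> \<omega> \<in> space M \<Longrightarrow> Z i \<omega> \<in> {a..b}" and ab: "a < b"
    and r: "0 < r"
    and mean: "\<And>n k. (\<Sum>i\<in>{n<..n + k}. expectation (Z i)) \<le> D - 2 * r * real k"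
    and p: "0 < p"
  obtains C where "\<And>n. prob {\<omega> \<in> space M. \<exists>k. (\<Sum>i\<in>{n<..n + k}. Z i \<omega>) > C - r * real k} \<le> p"
proof -
  define R where "R = (b - a)\<^sup>2"
  define x where "x = exp (- (2 * r\<^sup>2 / R))"
  have R: "0 < R" using ab by (simp add: R_def)
  have x: "0 < x" "x < 1" using r R by (auto simp: x_def)
  have D: "0 \<le> D" using mean[of 0 0] by simp
  define w where "w = ln (p * (1 - x))"
  \<comment> \<open>Solves \<open>exp (- 4 * r * E / R) = p * (1 - x)\<close>, the total of the geometric series being
    that exponential divided by \<open>1 - x\<close>.\<close>
  define E where "E = max 0 (- w * R / (4 * r))"
  have E: "0 \<le> E" by (simp add: E_def)
  have "- w * R / (4 * r) \<le> E" by (simp add: E_def)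
  hence "- w \<le> 4 * r * E / R" using R r by (simp add: field_simps)
  hence "exp (- (4 * r * E / R)) \<le> exp w" by simp
  hence Ex: "exp (- (4 * r * E / R)) \<le> p * (1 - x)" using p x by (simp add: w_def)
  define C where "C = D + E"
  have rv: "random_variable borel (Z i)" if "1 \<le> i" for i
    using ind that by (auto simp: indep_vars_def2)
  have tail: "prob {\<omega> \<in> space M. (\<Sum>i\<in>{n<..n + k}. Z i \<omega>) > C - r * real k}
      \<le> exp (- (4 * r * E / R)) * x ^ k" for n k
  proof (cases "k = 0")
    case True
    thus ?thesis using D E by (simp add: C_def)
  next
    case False
    define \<mu> where "\<mu> = (\<Sum>i\<in>{n<..n + k}. expectation (Z i))"
    define \<epsilon> where "\<epsilon> = E + r * real k"
    have \<epsilon>: "0 \<le> \<epsilon>" using E r by (simp add: \<epsilon>_def)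
    interpret H: Hoeffding_ineq M "{n<..n + k}" Z "\<lambda>_. a" "\<lambda>_. b" \<mu>
    proof unfold_locales
      show "indep_vars (\<lambda>_. borel) Z {n<..n + k}" by (rule indep_vars_subset[OF ind]) auto
      show "AE \<omega> in M. Z i \<omega> \<in> {a..b}" if "i \<in> {n<..n + k}" for i
        using bnd that by (intro AE_I2) auto
    qed (auto simp: \<mu>_def)
    have "prob {\<omega> \<in> space M. (\<Sum>i\<in>{n<..n + k}. Z i \<omega>) > C - r * real k}
        \<le> prob {\<omega> \<in> space M. (\<Sum>i\<in>{n<..n + k}. Z i \<omega>) \<ge> \<mu> + \<epsilon>}"
    proof (rule finite_measure_mono)
      show "{\<omega> \<in> space M. (\<Sum>i\<in>{n<..n + k}. Z i \<omega>) > C - r * real k}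
          \<subseteq> {\<omega> \<in> space M. (\<Sum>i\<in>{n<..n + k}. Z i \<omega>) \<ge> \<mu> + \<epsilon>}"
        using mean[of n k] by (auto simp: \<mu>_def \<epsilon>_def C_def)
      have [measurable]: "Z i \<in> borel_measurable M" if "i \<in> {n<..n + k}" for i
        using rv that by auto
      show "{\<omega> \<in> space M. (\<Sum>i\<in>{n<..n + k}. Z i \<omega>) \<ge> \<mu> + \<epsilon>} \<in> events" by measurable
    qed
    also have "\<dots> \<le> exp (- 2 * \<epsilon>\<^sup>2 / (\<Sum>i\<in>{n<..n + k}. (b - a)\<^sup>2))"
      using \<epsilon> False R by (intro H.Hoeffding_ineq_ge) (auto simp: R_def)
    also have "\<dots> = exp (- 2 * \<epsilon>\<^sup>2 / (real k * R))" by (simp add: R_def)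
    also have "\<dots> \<le> exp (- (4 * r * E / R) + real k * - (2 * r\<^sup>2 / R))"
    proof -
      have "2 * E * r * real k + r\<^sup>2 * (real k)\<^sup>2 \<le> \<epsilon>\<^sup>2"
        by (simp add: \<epsilon>_def power2_sum power_mult_distrib algebra_simps)
      hence "(4 * E * r * real k + 2 * r\<^sup>2 * (real k)\<^sup>2) / (real k * R) \<le> 2 * \<epsilon>\<^sup>2 / (real k * R)"
        using R False by (intro divide_right_mono) auto
      also have "(4 * E * r * real k + 2 * r\<^sup>2 * (real k)\<^sup>2) / (real k * R)
          = 4 * r * E / R + real k * (2 * r\<^sup>2 / R)"
        using R False by (simp add: field_simps power2_eq_square)
      finally show ?thesis by simp
    qed
    also have "\<dots> = exp (- (4 * r * E / R)) * x ^ k"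
      by (simp only: exp_add exp_of_nat_mult x_def)
    finally show ?thesis .
  qed
  show ?thesis
  proof (rule that[of C])
    fix n
    define B where "B k = {\<omega> \<in> space M. (\<Sum>i\<in>{n<..n + k}. Z i \<omega>) > C - r * real k}" for k
    have "B k \<in> events" for k
    proof -
      have [measurable]: "Z i \<in> borel_measurable M" if "i \<in> {n<..n + k}" for i
        using rv that by auto
      show ?thesis unfolding B_def by measurable
    qed
    hence rangeB: "range B \<subseteq> events" by auto
    have tailB: "prob (B k) \<le> exp (- (4 * r * E / R)) * x ^ k" for k
      unfolding B_def by (rule tail)
    have geo: "summable (\<lambda>k. exp (- (4 * r * E / R)) * x ^ k)"
      using x by (intro summable_mult summable_geometric) auto
    have sumB: "summable (\<lambda>k. prob (B k))"
      by (rule summable_comparison_test'[OF geo, of 0]) (simp add: tailB)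
    have "{\<omega> \<in> space M. \<exists>k. (\<Sum>i\<in>{n<..n + k}. Z i \<omega>) > C - r * real k} = (\<Union>k. B k)"
      by (auto simp: B_def)
    also have "prob \<dots> \<le> (\<Sum>k. prob (B k))"
      by (rule finite_measure_subadditive_countably[OF rangeB sumB])
    also have "\<dots> \<le> (\<Sum>k. exp (- (4 * r * E / R)) * x ^ k)"
      by (rule suminf_le[OF tailB sumB geo])
    also have "\<dots> = exp (- (4 * r * E / R)) / (1 - x)"
      using suminf_mult[of "\<lambda>k. x ^ k"] summable_geometric[of x] suminf_geometric[of x] x by simp
    also have "\<dots> \<le> p" using Ex x by (simp add: pos_divide_le_eq)
    finally show "prob {\<omega> \<in> space M. \<exists>k. (\<Sum>i\<in>{n<..n + k}. Z i \<omega>) > C - r * real k} \<le> p" .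
  qed
qed

lemma alternating_sum_le:
  fixes e :: "nat \<Rightarrow> real"
  assumes e: "\<And>i. 1 \<le> i \<Longrightarrow> e i = (if even (i + c) then u else v)"
    and neg: "u + v \<le> - lam" and lam: "0 \<le> lam"
  shows "(\<Sum>i\<in>{n<..n + k}. e i) \<le> \<bar>u\<bar> + \<bar>v\<bar> + lam - 2 * (lam / 4) * real k"
proof (induction k rule: induct_nat_012)
  case 0
  show ?case using lam by simp
next
  case 1
  have "{n<..n + Suc 0} = {Suc n}" by auto
  hence "(\<Sum>i\<in>{n<..n + Suc 0}. e i) = e (Suc n)" by simp
  also have "\<dots> \<le> \<bar>u\<bar> + \<bar>v\<bar>" by (subst e) auto
  finally show ?case using lam by simp
next
  case (ge2 k)
  have "{n<..n + Suc (Suc k)} = insert (Suc (Suc (n + k))) (insert (Suc (n + k)) {n<..n + k})"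
    by auto
  hence "(\<Sum>i\<in>{n<..n + Suc (Suc k)}. e i)
      = (e (Suc (Suc (n + k))) + e (Suc (n + k))) + (\<Sum>i\<in>{n<..n + k}. e i)" by simp
  also have "e (Suc (Suc (n + k))) + e (Suc (n + k)) = u + v"
    using e[of "Suc (Suc (n + k))"] e[of "Suc (n + k)"] by simp
  finally have "(\<Sum>i\<in>{n<..n + Suc (Suc k)}. e i) \<le> - lam + (\<Sum>i\<in>{n<..n + k}. e i)"
    using neg by simp
  moreover have "2 * (lam / 4) * real (Suc (Suc k)) = lam + 2 * (lam / 4) * real k"
    by (simp add: field_simps)
  ultimately show ?case using ge2.IH(1) by linarith
qed

lemma (in iid_noise) expectation_noise_eq:
  fixes h :: "real \<Rightarrow> real"
  assumes "h \<in> borel_measurable borel" and i: "1 \<le> i"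
  shows "expectation (\<lambda>\<omega>. h (\<xi> i \<omega>)) = expectation (\<lambda>\<omega>. h (\<xi> 1 \<omega>))"
proof -
  have "expectation (\<lambda>\<omega>. h (\<xi> i \<omega>)) = integral\<^sup>L (distr M borel (\<xi> i)) h"
    using assms random_variable_noise[OF i] by (simp add: integral_distr)
  also have "\<dots> = integral\<^sup>L (distr M borel (\<xi> 1)) h" using ident[OF i] by simp
  also have "\<dots> = expectation (\<lambda>\<omega>. h (\<xi> 1 \<omega>))"
    using assms random_variable_noise[of 1] by (simp add: integral_distr)
  finally show ?thesis .
qed

text \<open>
  Only the sum of the two means is assumed to be negative; one of them may be
  positive, which is why the drift has to be extracted from pairs of steps.
\<close>
lemma (in iid_noise) alternating_noise_drift:
  fixes g h :: "real \<Rightarrow> real"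
  assumes meas: "g \<in> borel_measurable borel" "h \<in> borel_measurable borel"
    and bnd: "\<And>x. \<bar>x\<bar> \<le> 1 \<Longrightarrow> g x \<in> {a..b}" "\<And>x. \<bar>x\<bar> \<le> 1 \<Longrightarrow> h x \<in> {a..b}" and ab: "a < b"
    and mean: "expectation (\<lambda>\<omega>. g (\<xi> 1 \<omega>)) + expectation (\<lambda>\<omega>. h (\<xi> 1 \<omega>)) = - lam"
    and lam: "0 < lam" and p: "0 < p"
  obtains C where "\<And>n. prob {\<omega> \<in> space M. \<exists>k. (\<Sum>i\<in>{n<..n + k}. (if even (i + c) then g else h) (\<xi> i \<omega>))
            > C - lam / 4 * real k} \<le> p"
proof -
  define Z where "Z i \<omega> = (if even (i + c) then g else h) (\<xi> i \<omega>)" for i \<omega>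
  define u where "u = expectation (\<lambda>\<omega>. g (\<xi> 1 \<omega>))"
  define v where "v = expectation (\<lambda>\<omega>. h (\<xi> 1 \<omega>))"
  show ?thesis
  proof (rule uniform_negative_drift[of Z a b "lam / 4" "\<bar>u\<bar> + \<bar>v\<bar> + lam" p])
    show "indep_vars (\<lambda>_. borel) Z {1..}"
      unfolding Z_def by (rule indep_vars_compose2[OF indep]) (use meas in auto)
    show "Z i \<omega> \<in> {a..b}" if "1 \<le> i" "\<omega> \<in> space M" for i \<omega>
      using bnd bounded[OF that] unfolding Z_def by auto
    show "(\<Sum>i\<in>{n<..n + k}. expectation (Z i)) \<le> \<bar>u\<bar> + \<bar>v\<bar> + lam - 2 * (lam / 4) * real k" for n k
    proof (rule alternating_sum_le)
      show "expectation (Z i) = (if even (i + c) then u else v)" if "1 \<le> i" for i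
        using expectation_noise_eq[OF meas(1) that] expectation_noise_eq[OF meas(2) that]
        unfolding Z_def u_def v_def by (cases "even (i + c)") simp_all
    qed (use mean lam in \<open>auto simp: u_def v_def\<close>)
  next
    fix C
    assume "\<And>n. prob {\<omega> \<in> space M. \<exists>k. (\<Sum>i\<in>{n<..n + k}. Z i \<omega>)
        > C - lam / 4 * real k} \<le> p"
    thus ?thesis unfolding Z_def by (rule that)
  qed (use ab lam p in auto)
qed

text \<open>
  The constant \<open>C\<close> is fixed before \<open>N\<close>: it determines how close to \<open>K\<close> the orbit has to come,
  and the number \<open>N\<close> of strong controls that achieves this is chosen afterwards.
\<close>
lemma (in iid_noise) AE_block_then_drift:
  fixes g h :: "real \<Rightarrow> real"
  assumes meas: "g \<in> borel_measurable borel" "h \<in> borel_measurable borel"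
    and bnd: "\<And>x. \<bar>x\<bar> \<le> 1 \<Longrightarrow> g x \<in> {a..b}" "\<And>x. \<bar>x\<bar> \<le> 1 \<Longrightarrow> h x \<in> {a..b}" and ab: "a < b"
    and mean: "expectation (\<lambda>\<omega>. g (\<xi> 1 \<omega>)) + expectation (\<lambda>\<omega>. h (\<xi> 1 \<omega>)) = - lam"
    and lam: "0 < lam" and \<epsilon>: "0 < \<epsilon>"
  obtains C where "\<And>N. AE \<omega> in M. \<exists>m. (\<forall>i\<in>{m<..m + N}. \<xi> i \<omega> \<in> {1 - \<epsilon><..1}) \<and>
      (\<forall>c\<in>{0, 1}. \<forall>k. (\<Sum>i\<in>{m + N<..m + N + k}. (if even (i + c) then g else h) (\<xi> i \<omega>))
          \<le> C - lam / 4 * real k)"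
proof -
  define W where "W c n k \<omega> = (\<Sum>i\<in>{n<..n + k}. (if even (i + c) then g else h) (\<xi> i \<omega>))"
    for c n k :: nat and \<omega>
  obtain C0 where C0: "\<And>n. prob {\<omega> \<in> space M. \<exists>k. W 0 n k \<omega> > C0 - lam / 4 * real k} \<le> 1 / 4"
    unfolding W_def using alternating_noise_drift[OF assms(1-7), of "1 / 4" 0] by auto
  obtain C1 where C1: "\<And>n. prob {\<omega> \<in> space M. \<exists>k. W 1 n k \<omega> > C1 - lam / 4 * real k} \<le> 1 / 4"
    unfolding W_def using alternating_noise_drift[OF assms(1-7), of "1 / 4" 1] by auto
  define C where "C = max C0 C1"
  have W_meas: "W c n k \<in> borel_measurable (noise_algebra {n<..})" for c n k
  proof -
    have "(\<lambda>\<omega>. (if even (i + c) then g else h) (\<xi> i \<omega>)) \<in> borel_measurable (noise_algebra {n<..})"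
      if "i \<in> {n<..n + k}" for i
      using measurable_noise_algebra[of i "{n<..}"] that meas
      by (cases "even (i + c)") (auto intro: measurable_compose)
    thus ?thesis unfolding W_def by (rule borel_measurable_sum)
  qed
  define Drift where "Drift n = {\<omega> \<in> space M. \<forall>c\<in>{0, 1}. \<forall>k. W c n k \<omega> \<le> C - lam / 4 * real k}" for n
  define Near where "Near m N = {\<omega> \<in> space M. \<forall>i\<in>{m<..m + N}. \<xi> i \<omega> \<in> {1 - \<epsilon><..1}}" for m N
  have Drift_alg: "Drift n \<in> sets (noise_algebra {n<..})" for n
  proof -
    note [measurable] = W_meas
    have "{\<omega> \<in> space (noise_algebra {n<..}). \<forall>c\<in>{0, 1}. \<forall>k. W c n k \<omega> \<le> C - lam / 4 * real k}
        \<in> sets (noise_algebra {n<..})" by measurable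
    thus ?thesis by (simp add: Drift_def)
  qed
  have Near_alg: "Near m N \<in> sets (noise_algebra {m<..m + N})" for m N
  proof -
    have [measurable]: "\<xi> i \<in> borel_measurable (noise_algebra {m<..m + N})" if "i \<in> {m<..m + N}" for i
      using that by (rule measurable_noise_algebra)
    have "{\<omega> \<in> space (noise_algebra {m<..m + N}). \<forall>i\<in>{m<..m + N}. \<xi> i \<omega> \<in> {1 - \<epsilon><..1}}
        \<in> sets (noise_algebra {m<..m + N})" by measurable
    thus ?thesis by (simp add: Near_def)
  qed
  have Drift_prob: "1 / 2 \<le> prob (Drift n)" for n
  proof -
    have ev: "Drift n \<in> events" 
      using Drift_alg[of n] sets_noise_algebra_events[of "{n<..}"] by force
    define Bad where "Bad c D = {\<omega> \<in> space M. \<exists>k. W c n k \<omega> > D - lam / 4 * real k}" for c D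
    have Bad_ev: "Bad c D \<in> events" for c D
    proof -
      have [measurable]: "W c n k \<in> borel_measurable M" for k
      proof (rule measurable_mono[THEN subsetD, OF _ _ _ _ W_meas])
        show "sets (noise_algebra {n<..}) \<subseteq> events" by (rule sets_noise_algebra_events) auto
      qed auto
      show ?thesis unfolding Bad_def by measurable
    qed
    have "space M - Drift n \<subseteq> Bad 0 C0 \<union> Bad 1 C1"
      by (auto simp: Drift_def Bad_def C_def not_le max_def split: if_splits) (smt (verit))+
    hence "prob (space M - Drift n) \<le> prob (Bad 0 C0 \<union> Bad 1 C1)"
      by (intro finite_measure_mono) (use Bad_ev in auto)
    also have "\<dots> \<le> prob (Bad 0 C0) + prob (Bad 1 C1)" by (intro measure_Un_le Bad_ev)
    also have "\<dots> \<le> 1 / 4 + 1 / 4" using C0[of n] C1[of n] by (intro add_mono) (auto simp: Bad_def)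
    finally show ?thesis using prob_compl[OF ev] by simp
  qed
  define p where "p = prob {\<omega> \<in> space M. \<xi> 1 \<omega> \<in> {1 - \<epsilon><..1}}"
  have p: "0 < p" unfolding p_def using near_one[of 1 \<epsilon>] \<epsilon> by simp
  have "AE \<omega> in M. \<exists>m. \<omega> \<in> Near m N \<inter> Drift (m + N)" for N
  proof (rule AE_some_future_event)
    show "Near m N \<inter> Drift (m + N) \<in> sets (noise_algebra {m<..})" for m
    proof (rule sets.Int)
      show "Near m N \<in> sets (noise_algebra {m<..})"
        by (rule noise_algebra_mono[OF Near_alg]) auto
      show "Drift (m + N) \<in> sets (noise_algebra {m<..})"
        by (rule noise_algebra_mono[OF Drift_alg]) auto
    qed
    show "0 < p ^ N * (1 / 2)" using p by simp
    show "p ^ N * (1 / 2) \<le> prob (Near m N \<inter> Drift (m + N))" for m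
    proof -
      have "prob (Near m N \<inter> Drift (m + N)) = prob (Near m N) * prob (Drift (m + N))"
        by (rule prob_Int_disjoint_times[OF _ _ _ Near_alg Drift_alg]) auto
      also have "prob (Near m N) = p ^ N"
        unfolding Near_def p_def by (rule prob_noise_block_near_one)
      finally show ?thesis using Drift_prob[of "m + N"] p by (simp add: mult_left_mono)
    qed
  qed
  thus ?thesis
    by (intro that[of C]) (auto simp: Near_def Drift_def W_def elim!: eventually_mono)
qed

section \<open>Almost sure stabilisation\<close>

theorem theorem3:
  fixes M :: "'a measure" and \<xi> :: "nat \<Rightarrow> 'a \<Rightarrow> real"
    and f :: "real \<Rightarrow> real"
    and K \<theta> Lm Lp a1 a2 \<alpha> l lam0 x0 :: real
  assumes noise: "iid_noise M \<xi>"
    and map: "unstable_map f K"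
    and theta: "\<theta> \<in> {0<..<K}"
    and slopes: "Lm \<ge> Lp" "Lp > 1"
    and a_pos: "a1 > 0" "a2 > 0"
    and upper_left: "\<And>x. x \<in> {K - \<theta>..K} \<Longrightarrow> f x - K \<le> Lm * (K - x)"
    and lower_right: "\<And>x. x \<in> {K..K + \<theta>} \<Longrightarrow> K - f x \<le> Lp * (x - K)"
    and lower_left: "\<And>x. x \<in> {K - \<theta><..<K} \<Longrightarrow> f x > a1 * (K - x) + K"
    and upper_right: "\<And>x. x \<in> {K<..<K + \<theta>} \<Longrightarrow> f x < a2 * (K - x) + K"
    and alpha: "\<alpha> \<in> {0<..<beta_star f K}"
    and ell: "l \<in> {beta_star f K - \<alpha><..<min \<alpha> (1 - \<alpha>)}"
    and sum_le: "\<alpha> + l \<le> min (a1 / (a1 + 1)) (a2 / (a2 + 1))"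
    and lambda_pos: "lam0 > 0"
    and log_mean: "prob_space.expectation M
        (\<lambda>\<omega>. ln \<bar>ctrl_slope Lm (\<alpha> + l * \<xi> 1 \<omega>) * ctrl_slope Lp (\<alpha> + l * \<xi> 1 \<omega>)\<bar>) = - lam0"
    and x0_pos: "x0 > 0"
  shows "AE \<omega> in M. (\<lambda>n. noisy_orbit f \<alpha> l (\<lambda>k. \<xi> k \<omega>) x0 n) \<longlonglongrightarrow> K"
proof -
  interpret iid_noise M \<xi> by (rule noise)
  interpret unstable_map f K by (rule map)
  define b where "b = \<alpha> + l"
  have l: "0 < l" "l < \<alpha>" and b: "b < 1" "beta_star f K < b"
    using ell alpha by (auto simp: b_def)
  have b_le: "b \<le> a1 / (a1 + 1)" "b \<le> a2 / (a2 + 1)" using sum_le by (auto simp: b_def)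
  have \<theta>: "0 < \<theta>" using theta by simp
  have near: "K - \<theta> / 2 \<in> {K - \<theta><..<K}" "K + \<theta> / 2 \<in> {K<..<K + \<theta>}" using \<theta> by auto
  have "f (K - \<theta> / 2) - K \<le> Lm * (\<theta> / 2)" "K - f (K + \<theta> / 2) \<le> Lp * (\<theta> / 2)"
    using upper_left[of "K - \<theta> / 2"] lower_right[of "K + \<theta> / 2"] \<theta> by simp_all
  moreover have "a1 * (\<theta> / 2) < f (K - \<theta> / 2) - K" "a2 * (\<theta> / 2) < K - f (K + \<theta> / 2)"
    using lower_left[OF near(1)] upper_right[OF near(2)] by simp_all
  ultimately have "a1 * (\<theta> / 2) < Lm * (\<theta> / 2)" "a2 * (\<theta> / 2) < Lp * (\<theta> / 2)"
    by linarith+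
  hence a1: "a1 < Lm" and a2: "a2 < Lp" using \<theta> by simp_all

  have "0 < a1 * (\<theta> / 2)" using a_pos \<theta> by simp
  hence "K < f_max f K"
    using lower_left[of "K - \<theta> / 2"] f_le_f_max[of "K - \<theta> / 2"] theta by auto
  hence "S_set f K \<noteq> {}"
    using \<theta> upper_left lower_right by (intro S_set_nonempty[of \<theta> Lm Lp]) auto
  then obtain s where s: "s \<in> S_set f K" "s < b"
    using cInf_lessD[of "S_set f K" b] b by (auto simp: beta_star_def)
  \<comment> \<open>Noise above \<open>1 - \<epsilon>\<close> is exactly control above \<open>s\<close>.\<close>
  define \<epsilon> where "\<epsilon> = (b - s) / l"
  have \<epsilon>: "0 < \<epsilon>" using s l by (simp add: \<epsilon>_def)
  have control: "\<alpha> + l * t \<in> {\<alpha> - l..b}" if "\<bar>t\<bar> \<le> 1" for t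
  proof -
    have "l * t \<le> l * 1" "l * - 1 \<le> l * t" using that l by (intro mult_left_mono; simp)+
    thus ?thesis by (simp add: b_def)
  qed

  define g where "g L t = ln (ctrl_slope L (\<alpha> + l * t))" for L t
  have g_meas: "g L \<in> borel_measurable borel" for L
    unfolding g_def ctrl_slope_def by measurable
  have slope_pos: "0 < ctrl_slope Lm (\<alpha> + l * t)" "0 < ctrl_slope Lp (\<alpha> + l * t)" if "\<bar>t\<bar> \<le> 1" for t
    using control[OF that] b_le a_pos a1 a2
    by (intro ctrl_slope_pos[of a1] ctrl_slope_pos[of a2]; simp)+
  \<comment> \<open>The log-slopes decrease in the noise, so their extremes are at \<open>- 1\<close> and \<open>1\<close>; the extra \<open>1\<close>
    keeps the interval nondegenerate.\<close>
  define lo where "lo = min (g Lm 1) (g Lp 1)"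
  define hi where "hi = max (g Lm (- 1)) (g Lp (- 1)) + 1"
  have g_between: "g L t \<in> {g L 1..g L (- 1)}" if "\<bar>t\<bar> \<le> 1" "L \<in> {Lm, Lp}" for L t
  proof -
    have "0 < ctrl_slope L (\<alpha> + l * u)" if "\<bar>u\<bar> \<le> 1" for u
      using slope_pos[OF that] \<open>L \<in> {Lm, Lp}\<close> by auto
    hence pos: "0 < ctrl_slope L (\<alpha> + l * 1)" "0 < ctrl_slope L (\<alpha> + l * t)"
      using \<open>\<bar>t\<bar> \<le> 1\<close> by (metis abs_one order_refl)+
    have "0 \<le> L" using that slopes by auto
    hence "ctrl_slope L (\<alpha> + l * 1) \<le> ctrl_slope L (\<alpha> + l * t)"
      "ctrl_slope L (\<alpha> + l * t) \<le> ctrl_slope L (\<alpha> + l * - 1)"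
      using control[OF that(1)] by (auto intro!: ctrl_slope_antimono simp: b_def)
    thus ?thesis using pos unfolding g_def by (simp add: ln_mono)
  qed
  have g_bnd: "g Lm t \<in> {lo..hi}" "g Lp t \<in> {lo..hi}" if "\<bar>t\<bar> \<le> 1" for t
    using g_between[OF that, of Lm] g_between[OF that, of Lp] by (auto simp: lo_def hi_def)
  have lohi: "lo < hi" using g_between[of 0 Lm] by (auto simp: lo_def hi_def)
  have g_int: "integrable M (\<lambda>\<omega>. g L (\<xi> 1 \<omega>))" if "L \<in> {Lm, Lp}" for L
  proof (rule integrable_const_bound)
    show "AE \<omega> in M. norm (g L (\<xi> 1 \<omega>)) \<le> \<bar>lo\<bar> + \<bar>hi\<bar>"
      using g_bnd[OF bounded[of 1]] that by (intro AE_I2) force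
    show "random_variable borel (\<lambda>\<omega>. g L (\<xi> 1 \<omega>))"
      by (rule measurable_compose[OF random_variable_noise g_meas]) simp
  qed
  have mean: "expectation (\<lambda>\<omega>. g Lm (\<xi> 1 \<omega>)) + expectation (\<lambda>\<omega>. g Lp (\<xi> 1 \<omega>)) = - lam0"
  proof -
    have "expectation (\<lambda>\<omega>. g Lm (\<xi> 1 \<omega>)) + expectation (\<lambda>\<omega>. g Lp (\<xi> 1 \<omega>))
        = expectation (\<lambda>\<omega>. g Lm (\<xi> 1 \<omega>) + g Lp (\<xi> 1 \<omega>))"
      by (intro Bochner_Integration.integral_add[symmetric] g_int) auto
    also have "\<dots> = expectation
        (\<lambda>\<omega>. ln \<bar>ctrl_slope Lm (\<alpha> + l * \<xi> 1 \<omega>) * ctrl_slope Lp (\<alpha> + l * \<xi> 1 \<omega>)\<bar>)"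
    proof (rule Bochner_Integration.integral_cong)
      fix \<omega> assume "\<omega> \<in> space M"
      hence "\<bar>\<xi> 1 \<omega>\<bar> \<le> 1" by (intro bounded) auto
      thus "g Lm (\<xi> 1 \<omega>) + g Lp (\<xi> 1 \<omega>)
          = ln \<bar>ctrl_slope Lm (\<alpha> + l * \<xi> 1 \<omega>) * ctrl_slope Lp (\<alpha> + l * \<xi> 1 \<omega>)\<bar>"
        using slope_pos[of "\<xi> 1 \<omega>"] by (simp add: g_def ln_mult abs_mult)
    qed simp
    finally show ?thesis using log_mean by simp
  qed
  obtain C where good: "\<And>N. AE \<omega> in M. \<exists>m. (\<forall>i\<in>{m<..m + N}. \<xi> i \<omega> \<in> {1 - \<epsilon><..1}) \<and>
      (\<forall>c\<in>{0, 1}. \<forall>k. (\<Sum>i\<in>{m + N<..m + N + k}. (if even (i + c) then g Lm else g Lp) (\<xi> i \<omega>))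
          \<le> C - lam0 / 4 * real k)"
    using AE_block_then_drift[OF g_meas g_meas g_bnd lohi mean lambda_pos \<epsilon>] by blast

  obtain A B where AB: "0 < A" "A \<le> K" "K \<le> B" "x0 \<in> {A..B}" "f ` {A..B} \<subseteq> {A..B}"
    using compact_invariant_interval[OF x0_pos] .
  have \<delta>: "0 < \<theta> * exp (- C)" using \<theta> by simp
  obtain N where N: "\<forall>x \<in> reachable f {s..b} {A..B} N. \<bar>x - K\<bar> < \<theta> * exp (- C)"
    using uniform_attraction[OF s(1) less_imp_le[OF s(2)] b(1) AB(1-3,5) \<delta>] by (rule exE)
  show ?thesis
    using good[of N] AE_space
  proof eventually_elim
    case (elim \<omega>)
    then obtain m where near: "\<And>i. i \<in> {m<..m + N} \<Longrightarrow> \<xi> i \<omega> \<in> {1 - \<epsilon><..1}"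
      and drift: "\<And>c k. c \<in> {0, 1} \<Longrightarrow> (\<Sum>i\<in>{m + N<..m + N + k}.
          (if even (i + c) then g Lm else g Lp) (\<xi> i \<omega>)) \<le> C - lam0 / 4 * real k"
      by blast
    define x where "x = noisy_orbit f \<alpha> l (\<lambda>k. \<xi> k \<omega>) x0"
    have ctrl: "\<alpha> + l * \<xi> i \<omega> \<in> {\<alpha> - l..b}" if "1 \<le> i" for i
      using control bounded[OF that elim(2)] by blast
    have x_mem: "x n \<in> {A..B}" for n
      unfolding x_def
    proof (rule noisy_orbit_mem_invariant_interval[OF AB(4,5)])
      fix i :: nat assume "1 \<le> i"
      thus "\<alpha> + l * \<xi> i \<omega> \<in> {0..1}" using ctrl[of i] l b by auto
    qed
    have "x (m + N) \<in> reachable f {s..b} {A..B} N"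
    proof (rule orbit_mem_reachable[where y = "\<lambda>n. x (m + n)" and \<beta> = "\<lambda>n. \<alpha> + l * \<xi> (Suc (m + n)) \<omega>"])
      fix n assume "n < N"
      hence "1 - \<epsilon> < \<xi> (Suc (m + n)) \<omega>" using near[of "Suc (m + n)"] by auto
      hence "l * (1 - \<epsilon>) < l * \<xi> (Suc (m + n)) \<omega>" using l by simp
      moreover have "l * (1 - \<epsilon>) = s - \<alpha>" using l by (simp add: \<epsilon>_def b_def field_simps)
      ultimately show "\<alpha> + l * \<xi> (Suc (m + n)) \<omega> \<in> {s..b}" using ctrl[of "Suc (m + n)"] by simp
      show "x (m + Suc n) = G f (\<alpha> + l * \<xi> (Suc (m + n)) \<omega>) (x (m + n))"
        unfolding x_def add_Suc_right by (rule noisy_orbit_Suc_eq_G)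
    qed (use x_mem[of m] in simp)
    hence close: "\<bar>x (m + N) - K\<bar> < \<theta> * exp (- C)" using N by blast
    have r: "0 < lam0 / 4" using lambda_pos by simp
    show ?case
    proof (rule noisy_orbit_tendsto_equilibrium
        [OF a_pos(1) a1 a_pos(2) a2 upper_left lower_right lower_left upper_right _ _ close[unfolded x_def] r])
      show "\<alpha> + l * \<xi> i \<omega> \<le> a1 / (a1 + 1)" "\<alpha> + l * \<xi> i \<omega> \<le> a2 / (a2 + 1)" if "1 \<le> i" for i
        using ctrl[OF that] b_le by auto
      show "(\<Sum>i\<in>{m + N<..m + N + k}. ln (ctrl_slope (if even (i + c) then Lm else Lp)
          (\<alpha> + l * \<xi> i \<omega>))) \<le> C - lam0 / 4 * real k" if "c \<in> {0, 1}" for c k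
      proof -
        have "(\<Sum>i\<in>{m + N<..m + N + k}. ln (ctrl_slope (if even (i + c) then Lm else Lp)
            (\<alpha> + l * \<xi> i \<omega>)))
          = (\<Sum>i\<in>{m + N<..m + N + k}. (if even (i + c) then g Lm else g Lp) (\<xi> i \<omega>))"
          by (intro sum.cong) (auto simp: g_def)
        thus ?thesis using drift[OF that, of k] by simp
      qed
    qed
  qed
qed

end
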